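(* Let $X$ be an infinite-dimensional separable $F$-space, let $(Y_i)_{i\in\mathbb{N}}$ be topological vector spaces, and for each $i\in\mathbb{N}$ let $(T_{i,n}: X\to Y_i)_{n\in\mathbb{N}}$ be a sequence of linear operators. For each $i\in\mathbb{N}$ let $\Psi_i$ be a $D$-phenomenon from $X$ to $Y_i$ and let $\mathcal{F}_i$ be a proper Furstenberg family. Suppose that for every $m,i\in\mathbb{N}$ the set $\mathcal{F}_i\Psi_i((T_{i,n})_n : m)\subset X^m$ contains a residual subset of $X^m$. Then for each $m\in\mathbb{N}$ the set $$\bigcap_{i\in\mathbb{N}}\mathcal{F}_i\Psi_i((T_{i,n})_n : m)\subset X^m$$ is dense-lineable (in $X^m$).
   Context: An $F$-space is a completely metrizable topological vector space. A subset $A$ of a topological vector space $Z$ is dense-lineable if $A\cup\{0\}$ contains a dense vector subspace of $Z$. A set is residual if it contains a countable intersection of dense open sets. $D$-phenomenon: for topological vector spaces $X,Y$, a $D$-phenomenon $\Psi$ from $X$ to $Y$ assigns to each $x\in X$ a non-empty set $\Psi(x)$ of open subsets of $Y$ such that: for any $p=\sum_{j=1}^{m}\alpha_j x_j\in X$ with all scalars $\alpha_j\neq 0$ and any $V\in\Psi(p)$, there exist non-empty open sets $W_j\in\Psi(x_j)$, $j=1,\dots,m$, with $\sum_{j=1}^{m}\alpha_j W_j\subset V$. For $(x_1,\dots,x_m)\in X^m$ define $\Psi(x_1,\dots,x_m):=\{\prod_{j=1}^m A_j\subset Y^m : A_j\in\Psi(x_j)\}$. A Furstenberg family is a non-empty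 family $\mathcal{F}$ of subsets of $\mathbb{N}_0$ that is hereditary upward ($A\in\mathcal{F}$, $A\subset B$ imply $B\in\mathcal{F}$); it is proper if $\emptyset\notin\mathcal{F}$. For a sequence of operators $T_n:X\to Y$, a $D$-phenomenon $\Psi$ from $X$ to $Y$ and a proper Furstenberg family $\mathcal{F}$, the set $\mathcal{F}\Psi((T_n)_n:m)\subset X^m$ consists of all $q=(x_1,\dots,x_m)\in X^m$ such that for every $V\in\Psi(x_1,\dots,x_m)$ one has $\{n\in\mathbb{N}: (T_n(x_1),\dots,T_n(x_m))\in V\}\in\mathcal{F}$. *)

theory Defs
  imports "HOL-Analysis.Analysis" "Jordan_Normal_Form.Missing_VectorSpace"
begin

text \<open>
  Spaces are given by explicit carriers (records of type \<^typ>\<open>('k, 'v) module\<close>), so that the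
  members of a sequence \<open>Y 1, Y 2, \<dots>\<close> may be entirely different vector spaces. The record
  fields for the ring multiplication and unit of the module play no role. The scalar type ranges
  over class \<^class>\<open>real_normed_field\<close>, whose only members up to isomorphism are the
  real and the complex numbers (Gelfand--Mazur). Throughout, \<open>\<nat>\<close> is \<open>{1, 2, \<dots>}\<close>, and
  \<open>\<nat>\<^sub>0\<close> is the type \<^typ>\<open>nat\<close>.
\<close>

definition scalar_field :: "'k::field ring" where
  "scalar_field = \<lparr>carrier = UNIV, mult = (*), one = 1, zero = 0, add = (+)\<rparr>"

text \<open>No separation axiom is included.\<close>

definition topological_vector_space ::
    "('k::real_normed_field, 'v) module \<Rightarrow> 'v topology \<Rightarrow> bool" where
  "topological_vector_space V \<tau> \<longleftrightarrow>
     vectorspace scalar_field V \<and>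
     topspace \<tau> = carrier V \<and>
     continuous_map (prod_topology \<tau> \<tau>) \<tau> (\<lambda>(x, y). x \<oplus>\<^bsub>V\<^esub> y) \<and>
     continuous_map (prod_topology euclidean \<tau>) \<tau> (\<lambda>(a, x). a \<odot>\<^bsub>V\<^esub> x)"

definition F_space :: "('k::real_normed_field, 'v) module \<Rightarrow> 'v topology \<Rightarrow> bool" where
  "F_space V \<tau> \<longleftrightarrow> topological_vector_space V \<tau> \<and> completely_metrizable_space \<tau>"

definition infinite_dimensional :: "('k::field, 'v) module \<Rightarrow> bool" where
  "infinite_dimensional V \<longleftrightarrow> \<not> vectorspace.fin_dim scalar_field V"

text \<open>
  The power \<open>V\<^sup>m\<close>: an \<open>m\<close>-tuple is a function on \<open>{1..m}\<close>, extended by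
  \<^const>\<open>undefined\<close> outside, as in \<^const>\<open>product_topology\<close>.
\<close>

definition power_space :: "nat \<Rightarrow> ('k, 'v) module \<Rightarrow> ('k, nat \<Rightarrow> 'v) module" where
  "power_space m V =
     \<lparr>carrier = {1..m} \<rightarrow>\<^sub>E carrier V,
      mult = (\<lambda>p q. \<lambda>j\<in>{1..m}. p j \<otimes>\<^bsub>V\<^esub> q j),
      one = (\<lambda>j\<in>{1..m}. \<one>\<^bsub>V\<^esub>),
      zero = (\<lambda>j\<in>{1..m}. \<zero>\<^bsub>V\<^esub>),
      add = (\<lambda>p q. \<lambda>j\<in>{1..m}. p j \<oplus>\<^bsub>V\<^esub> q j),
      smult = (\<lambda>a p. \<lambda>j\<in>{1..m}. a \<odot>\<^bsub>V\<^esub> p j)\<rparr>"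

definition power_topology :: "nat \<Rightarrow> 'v topology \<Rightarrow> (nat \<Rightarrow> 'v) topology" where
  "power_topology m \<tau> = product_topology (\<lambda>_. \<tau>) {1..m}"

definition dense_lineable ::
    "('k::real_normed_field, 'v) module \<Rightarrow> 'v topology \<Rightarrow> 'v set \<Rightarrow> bool" where
  "dense_lineable Z \<tau> A \<longleftrightarrow>
     (\<exists>W. VectorSpace.subspace scalar_field W Z \<and> W \<subseteq> A \<union> {\<zero>\<^bsub>Z\<^esub>} \<and>
          \<tau> closure_of W = topspace \<tau>)"

definition residual_in :: "'v topology \<Rightarrow> 'v set \<Rightarrow> bool" where
  "residual_in \<tau> R \<longleftrightarrow> R \<subseteq> topspace \<tau> \<and>
     (\<exists>\<U>. countable \<U> \<and> (\<forall>U\<in>\<U>. openin \<tau> U \<and> \<tau> closure_of U = topspace \<tau>) \<and>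
          topspace \<tau> \<inter> \<Inter>\<U> \<subseteq> R)"

definition D_phenomenon ::
    "('k::real_normed_field, 'a) module \<Rightarrow> ('k, 'b) module \<Rightarrow> 'b topology
       \<Rightarrow> ('a \<Rightarrow> 'b set set) \<Rightarrow> bool" where
  "D_phenomenon X Y \<tau>Y \<Psi> \<longleftrightarrow>
     (\<forall>x\<in>carrier X. \<Psi> x \<noteq> {} \<and> (\<forall>V\<in>\<Psi> x. openin \<tau>Y V)) \<and>
     (\<forall>(m::nat) (\<alpha>::nat \<Rightarrow> 'k) (x::nat \<Rightarrow> 'a). 1 \<le> m \<longrightarrow>
        (\<forall>j\<in>{1..m}. \<alpha> j \<noteq> 0 \<and> x j \<in> carrier X) \<longrightarrow>
        (\<forall>V\<in>\<Psi> (\<Oplus>\<^bsub>X\<^esub>j\<in>{1..m}. \<alpha> j \<odot>\<^bsub>X\<^esub> x j).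
           \<exists>W. (\<forall>j\<in>{1..m}. W j \<in> \<Psi> (x j) \<and> W j \<noteq> {} \<and> openin \<tau>Y (W j)) \<and>
               {(\<Oplus>\<^bsub>Y\<^esub>j\<in>{1..m}. \<alpha> j \<odot>\<^bsub>Y\<^esub> w j) |w. \<forall>j\<in>{1..m}. w j \<in> W j} \<subseteq> V))"

definition tuple_phenomenon ::
    "nat \<Rightarrow> ('a \<Rightarrow> 'b set set) \<Rightarrow> (nat \<Rightarrow> 'a) \<Rightarrow> (nat \<Rightarrow> 'b) set set" where
  "tuple_phenomenon m \<Psi> x = {Pi\<^sub>E {1..m} A |A. \<forall>j\<in>{1..m}. A j \<in> \<Psi> (x j)}"

definition Furstenberg_family :: "nat set set \<Rightarrow> bool" where
  "Furstenberg_family \<F> \<longleftrightarrow> \<F> \<noteq> {} \<and> (\<forall>A B. A \<in> \<F> \<longrightarrow> A \<subseteq> B \<longrightarrow> B \<in> \<F>)"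

definition proper_Furstenberg_family :: "nat set set \<Rightarrow> bool" where
  "proper_Furstenberg_family \<F> \<longleftrightarrow> Furstenberg_family \<F> \<and> {} \<notin> \<F>"

definition F_Psi ::
    "('k, 'a) module \<Rightarrow> nat set set \<Rightarrow> ('a \<Rightarrow> 'b set set) \<Rightarrow> (nat \<Rightarrow> 'a \<Rightarrow> 'b) \<Rightarrow> nat
       \<Rightarrow> (nat \<Rightarrow> 'a) set" where
  "F_Psi X \<F> \<Psi> T m =
     {x \<in> carrier (power_space m X).
        \<forall>V\<in>tuple_phenomenon m \<Psi> x. {n. 1 \<le> n \<and> (\<lambda>j\<in>{1..m}. T n (x j)) \<in> V} \<in> \<F>}"

end

theory Submission
  imports Defs
begin

text \<open>
  In \<open>X\<^bsup>\<nat>\<^esup>\<close>, which is again completely metrizable, a generic sequence \<open>u\<close> has all its initial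
  segments \<open>(u\<^sub>1, \<dots>, u\<^sub>N)\<close> in the given residual sets, and its consecutive blocks of length \<open>m\<close>
  form a dense sequence in \<open>X\<^sup>m\<close>. The span of these blocks is the required dense subspace: if
  \<open>p\<close> is a combination of the first \<open>L\<close> blocks with some nonzero coefficient, then the defining
  property of a \<open>D\<close>-phenomenon shrinks any \<open>V \<in> \<Psi>(p)\<close> to a member of \<open>\<Psi>(u\<^sub>1, \<dots>, u\<^bsub>Lm\<^esub>)\<close>, and
  by linearity the return times of the latter are return times of \<open>p\<close> to \<open>V\<close>.
\<close>

section \<open>Generic sequences\<close>

text \<open>The balls of radius \<open>1 / (real n + 1)\<close> around the points of a countable
  dense set form a base. Second countability is what later reduces density of the blocks to
  countably many conditions.\<close>

lemma separable_metrizable_imp_second_countable: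
  assumes "metrizable_space X" and "separable_space X"
  shows "second_countable X"
proof -
  obtain M d where Md: "Metric_space M d" and X: "X = Metric_space.mtopology M d"
    using assms(1) unfolding metrizable_space_def by blast
  interpret Metric_space M d by (fact Md)
  obtain C where C: "countable C" "C \<subseteq> M" and dense: "mtopology closure_of C = M"
    using assms(2) unfolding separable_space_def X by auto
  define \<B> where "\<B> = (\<lambda>(c, n::nat). mball c (1 / (real n + 1))) ` (C \<times> UNIV)"
  have "\<exists>V\<in>\<B>. x \<in> V \<and> V \<subseteq> U" if U: "openin mtopology U" "x \<in> U" for U x
  proof -
    from U obtain r where r: "r > 0" "mball x r \<subseteq> U" and x: "x \<in> M"
      unfolding openin_mtopology by blast
    \<comment> \<open>Half of \<open>r\<close>, since the radius enters the triangle inequality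
      twice: from \<open>x\<close> to the centre \<open>c\<close>, and from \<open>c\<close> to
      \<open>y\<close>.\<close>
    obtain n :: nat where n: "1 / (real n + 1) < r / 2"
      using reals_Archimedean[of "r / 2"] r(1) by (auto simp: inverse_eq_divide add.commute)
    have "x \<in> mball x (1 / (real n + 1))" using x by (simp add: add_pos_nonneg)
    then have "mball x (1 / (real n + 1)) \<noteq> {}" by blast
    with dense have "C \<inter> mball x (1 / (real n + 1)) \<noteq> {}"
      using dense_intersects_open[of mtopology C] openin_mball[of x "1 / (real n + 1)"]
      unfolding topspace_mtopology by blast
    then obtain c where c: "c \<in> C" "d x c < 1 / (real n + 1)" by auto
    have "c \<in> M" using c C by auto
    have "mball c (1 / (real n + 1)) \<subseteq> mball x r"
    proof
      fix y assume "y \<in> mball c (1 / (real n + 1))"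
      then have "y \<in> M" "d c y < 1 / (real n + 1)" by auto
      then show "y \<in> mball x r"
        using triangle[OF x \<open>c \<in> M\<close> \<open>y \<in> M\<close>] c n x by auto
    qed
    moreover have "x \<in> mball c (1 / (real n + 1))"
      using c x \<open>c \<in> M\<close> by (auto simp: commute)
    ultimately show ?thesis
      using r c unfolding \<B>_def by (intro bexI[of _ "mball c (1 / (real n + 1))"]) force+
  qed
  moreover have "countable \<B>" unfolding \<B>_def using C by auto
  moreover have "\<forall>V\<in>\<B>. openin mtopology V" unfolding \<B>_def by auto
  ultimately show ?thesis unfolding second_countable_def X by blast
qed

text \<open>Conditions on finitely many coordinates lift to the full product. Restriction is
  continuous, which gives openness. For density, a point of a basic box is altered only on
  \<open>J\<close>, where the density of \<open>U\<close> supplies new coordinates inside the same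
  box; finiteness of \<open>J\<close> makes the restricted box open.\<close>

lemma open_dense_restrict_preimage:
  assumes "openin (product_topology X J) U"
    and dense: "product_topology X J closure_of U = topspace (product_topology X J)"
    and "finite J" and "J \<subseteq> I"
  defines "P \<equiv> {u \<in> topspace (product_topology X I). restrict u J \<in> U}"
  shows "openin (product_topology X I) P"
    and "product_topology X I closure_of P = topspace (product_topology X I)"
proof -
  have "continuous_map (product_topology X I) (product_topology X J) (\<lambda>u. restrict u J)"
    using \<open>J \<subseteq> I\<close> by (auto simp: continuous_map_componentwise)
  then show "openin (product_topology X I) P"
    unfolding P_def using assms(1) by (rule openin_continuous_map_preimage)
  show "product_topology X I closure_of P = topspace (product_topology X I)"
    unfolding dense_intersects_open
  proof (intro allI impI, elim conjE)
    fix S assume S: "openin (product_topology X I) S" "S \<noteq> {}"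
    then obtain x where "x \<in> S" by blast
    then obtain B where B: "x \<in> Pi\<^sub>E I B" "\<And>i. openin (X i) (B i)" "Pi\<^sub>E I B \<subseteq> S"
      using product_topology_open_contains_basis[OF S(1)] by metis
    have "openin (product_topology X J) (Pi\<^sub>E J B)"
      using B \<open>finite J\<close> by (simp add: openin_PiE)
    moreover have "restrict x J \<in> Pi\<^sub>E J B" using B(1) \<open>J \<subseteq> I\<close> by auto
    ultimately obtain y where y: "y \<in> U" "y \<in> Pi\<^sub>E J B"
      using dense unfolding dense_intersects_open by blast
    \<comment> \<open>Splicing \<open>y\<close> into \<open>x\<close> stays in the box, because both
      points satisfy its constraints on their own coordinates.\<close>
    define u where "u = (\<lambda>i. if i \<in> J then y i else x i)"
    have "u \<in> Pi\<^sub>E I B" using y B(1) \<open>J \<subseteq> I\<close> by (auto simp: u_def PiE_iff extensional_def)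
    moreover have "restrict u J = y" using y(2) by (auto simp: u_def PiE_iff extensional_def)
    moreover have "u \<in> topspace (product_topology X I)"
      using \<open>u \<in> Pi\<^sub>E I B\<close> B(3) S(1) openin_subset by blast
    ultimately show "P \<inter> S \<noteq> {}" using y B(3) unfolding P_def by auto
  qed
qed

text \<open>Density holds because a basic open set of the infinite product constrains only finitely
  many coordinates, so a block lying far enough out can be prescribed freely.\<close>

lemma open_dense_block_visits:
  fixes X :: "'a topology" and m :: nat
  assumes "1 \<le> m" and B: "\<And>j. j \<in> {1..m} \<Longrightarrow> openin X (B j) \<and> B j \<noteq> {}"
  defines "P \<equiv> {u \<in> topspace (product_topology (\<lambda>_. X) UNIV).
                  \<exists>l::nat. \<forall>j\<in>{1..m}. u (l * m + j) \<in> B j}"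
  shows "openin (product_topology (\<lambda>_. X) UNIV) P"
    and "product_topology (\<lambda>_. X) UNIV closure_of P = topspace (product_topology (\<lambda>_. X) UNIV)"
proof -
  let ?T = "product_topology (\<lambda>_::nat. X) UNIV"
  have "openin ?T {u \<in> topspace ?T. u k \<in> B j}" if "j \<in> {1..m}" for k j
    using continuous_map_product_projection[of k UNIV "\<lambda>_. X"] B[OF that]
    by (intro openin_continuous_map_preimage[where Y = X]) auto
  then have "openin ?T (\<Inter>j\<in>{1..m}. {u \<in> topspace ?T. u (l * m + j) \<in> B j})" for l
    using \<open>1 \<le> m\<close> by (intro openin_INT2) auto
  then have "openin ?T (\<Union>l. \<Inter>j\<in>{1..m}. {u \<in> topspace ?T. u (l * m + j) \<in> B j})"
    by blast
  also have "(\<Union>l. \<Inter>j\<in>{1..m}. {u \<in> topspace ?T. u (l * m + j) \<in> B j}) = P"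
    unfolding P_def using \<open>1 \<le> m\<close> by (auto 4 3)
  finally show "openin ?T P" .
  show "?T closure_of P = topspace ?T"
    unfolding dense_intersects_open
  proof (intro allI impI, elim conjE)
    fix S assume S: "openin ?T S" "S \<noteq> {}"
    then obtain x where "x \<in> S" by blast
    then obtain A where A: "x \<in> Pi\<^sub>E UNIV A" "\<And>i. openin X (A i)"
        "finite {i. A i \<noteq> topspace X}" "Pi\<^sub>E UNIV A \<subseteq> S"
      using product_topology_open_contains_basis[OF S(1)] by metis
    \<comment> \<open>Block number \<open>l\<close> starts after position \<open>l * m\<close>,
      which is at least \<open>l\<close> as \<open>m\<close> is positive; hence it avoids every
      constrained coordinate.\<close>
    obtain l where l: "\<And>i. A i \<noteq> topspace X \<Longrightarrow> i < l"
      using A(3) unfolding finite_nat_set_iff_bounded by blast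
    obtain z where z: "\<And>j. j \<in> {1..m} \<Longrightarrow> z j \<in> B j"
      using B that[of "\<lambda>j. SOME b. b \<in> B j"] by (simp add: some_in_eq)
    define u where "u = (\<lambda>i. if i \<in> {l * m + 1..l * m + m} then z (i - l * m) else x i)"
    have "u i \<in> A i" for i
    proof (cases "i \<in> {l * m + 1..l * m + m}")
      case True
      have "l \<le> l * m" using \<open>1 \<le> m\<close> by simp
      also have "l * m < i" using True by simp
      finally have "A i = topspace X" using l not_less_iff_gr_or_eq by blast
      moreover have "i - l * m \<in> {1..m}" using True by auto
      then have "z (i - l * m) \<in> topspace X" using z B openin_subset by blast
      ultimately show ?thesis using True by (simp add: u_def)
    qed (use A in \<open>auto simp: u_def\<close>)
    then have "u \<in> S" using A(4) by auto
    moreover have "u (l * m + j) \<in> B j" if "j \<in> {1..m}" for j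
      using z[OF that] that by (auto simp: u_def)
    ultimately have "u \<in> P" using openin_subset[OF S(1)] unfolding P_def by blast
    with \<open>u \<in> S\<close> show "P \<inter> S \<noteq> {}" by blast
  qed
qed

text \<open>Both requirements on \<open>u\<close> amount to countably many dense open conditions on
  the sequence space, so the Baire category theorem yields one sequence meeting them all. The sets
  \<open>R N i\<close> are needed for every length \<open>N\<close>, since combinations of
  arbitrarily many blocks occur later.\<close>

lemma generic_sequence:
  fixes X :: "'a topology" and m :: nat
  assumes X: "completely_metrizable_space X" "separable_space X" "topspace X \<noteq> {}"
    and "1 \<le> m"
    and R: "\<And>N i::nat. 1 \<le> N \<Longrightarrow> 1 \<le> i \<Longrightarrow> residual_in (power_topology N X) (R N i)"
  obtains u :: "nat \<Rightarrow> 'a"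
  where "range u \<subseteq> topspace X"
    and "\<And>N i. 1 \<le> N \<Longrightarrow> 1 \<le> i \<Longrightarrow> restrict u {1..N} \<in> R N i"
    and "power_topology m X closure_of range (\<lambda>l. \<lambda>j\<in>{1..m}. u (l * m + j))
           = topspace (power_topology m X)"
proof -
  let ?T = "product_topology (\<lambda>_::nat. X) UNIV"
  have "\<forall>N i. \<exists>\<U>. 1 \<le> N \<and> 1 \<le> i \<longrightarrow> countable \<U> \<and>
          (\<forall>U\<in>\<U>. openin (power_topology N X) U \<and>
                  power_topology N X closure_of U = topspace (power_topology N X)) \<and>
          topspace (power_topology N X) \<inter> \<Inter>\<U> \<subseteq> R N i"
    using R unfolding residual_in_def by meson
  then obtain \<U> where \<U>: "\<And>N i. 1 \<le> N \<Longrightarrow> 1 \<le> i \<Longrightarrow> countable (\<U> N i)"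
      "\<And>N i U. 1 \<le> N \<Longrightarrow> 1 \<le> i \<Longrightarrow> U \<in> \<U> N i \<Longrightarrow> openin (power_topology N X) U \<and>
                  power_topology N X closure_of U = topspace (power_topology N X)"
      "\<And>N i. 1 \<le> N \<Longrightarrow> 1 \<le> i \<Longrightarrow> topspace (power_topology N X) \<inter> \<Inter>(\<U> N i) \<subseteq> R N i"
    by metis
  obtain \<B>\<^sub>0 where \<B>\<^sub>0: "countable \<B>\<^sub>0" "\<And>V. V \<in> \<B>\<^sub>0 \<Longrightarrow> openin X V"
      "\<And>U x. openin X U \<Longrightarrow> x \<in> U \<Longrightarrow> \<exists>V\<in>\<B>\<^sub>0. x \<in> V \<and> V \<subseteq> U"
    using separable_metrizable_imp_second_countable[OF completely_metrizable_imp_metrizable_space]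
      X unfolding second_countable_def by metis
  \<comment> \<open>The empty set is discarded because \<open>vis B\<close> is dense only when every
    factor \<open>B j\<close> is non-empty.\<close>
  define \<B> where "\<B> = \<B>\<^sub>0 - {{}}"
  define pre where "pre N U = {u \<in> topspace ?T. restrict u {1..N} \<in> U}" for N :: nat and U
  define vis where
    "vis B = {u \<in> topspace ?T. \<exists>l::nat. \<forall>j\<in>{1..m}. u (l * m + j) \<in> B j}" for B
  define \<G> where "\<G> = (\<Union>N\<in>{1..}. \<Union>i\<in>{1..}. pre N ` \<U> N i) \<union> vis ` ({1..m} \<rightarrow>\<^sub>E \<B>)"
  have "countable \<G>"
    unfolding \<G>_def \<B>_def using \<U>(1) \<B>\<^sub>0(1)
    by (intro countable_Un countable_UN countable_image countable_PiE) auto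
  moreover have "openin ?T G \<and> ?T closure_of G = topspace ?T" if G: "G \<in> \<G>" for G
  proof -
    consider N i U where "1 \<le> N" "1 \<le> i" "U \<in> \<U> N i" "G = pre N U"
      | B where "B \<in> {1..m} \<rightarrow>\<^sub>E \<B>" "G = vis B"
      using G unfolding \<G>_def by auto
    then show ?thesis
    proof cases
      case 1
      then show ?thesis
        using \<U>(2)[of N i U] open_dense_restrict_preimage[of "\<lambda>_. X" "{1..N}" U UNIV]
        unfolding power_topology_def pre_def by auto
    next
      case 2
      have "\<And>j. j \<in> {1..m} \<Longrightarrow> openin X (B j) \<and> B j \<noteq> {}"
        using 2 \<B>\<^sub>0(2) unfolding \<B>_def by blast
      then show ?thesis
        using open_dense_block_visits[OF \<open>1 \<le> m\<close>, of X B] 2 unfolding vis_def by auto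
    qed
  qed
  \<comment> \<open>Complete metrizability passes to countable products, so the Baire category
    theorem applies to the sequence space.\<close>
  moreover have "completely_metrizable_space ?T"
    using X by (simp add: completely_metrizable_space_product_topology)
  ultimately have "?T closure_of \<Inter>\<G> = topspace ?T"
    by (intro Baire_category) auto
  \<comment> \<open>A dense set has a point only if the space has one.\<close>
  moreover have "topspace ?T \<noteq> {}" using X(3) by (auto simp: PiE_eq_empty_iff)
  ultimately obtain u where u: "u \<in> \<Inter>\<G>" "u \<in> topspace ?T"
    unfolding dense_intersects_open using openin_topspace by blast
  have uX: "u k \<in> topspace X" for k using u(2) by auto
  show ?thesis
  proof
    show "range u \<subseteq> topspace X" using uX by auto
    show "restrict u {1..N} \<in> R N i" if "1 \<le> N" "1 \<le> i" for N i
    proof -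
      have "restrict u {1..N} \<in> U" if "U \<in> \<U> N i" for U
      proof -
        have "pre N U \<in> \<G>" unfolding \<G>_def using that \<open>1 \<le> N\<close> \<open>1 \<le> i\<close> by auto
        then show ?thesis using u(1) unfolding pre_def by auto
      qed
      moreover have "restrict u {1..N} \<in> topspace (power_topology N X)"
        using uX by (auto simp: power_topology_def)
      ultimately show ?thesis using \<U>(3)[OF that] by blast
    qed
    show "power_topology m X closure_of range (\<lambda>l. \<lambda>j\<in>{1..m}. u (l * m + j))
           = topspace (power_topology m X)"
      unfolding dense_intersects_open
    proof (intro allI impI, elim conjE)
      fix S assume S: "openin (power_topology m X) S" "S \<noteq> {}"
      then obtain x where "x \<in> S" by blast
      then obtain A where A: "x \<in> Pi\<^sub>E {1..m} A" "\<And>j. openin X (A j)" "Pi\<^sub>E {1..m} A \<subseteq> S"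
        using product_topology_open_contains_basis[OF S(1)[unfolded power_topology_def]] by metis
      have "\<forall>j\<in>{1..m}. \<exists>V. V \<in> \<B> \<and> V \<subseteq> A j"
        using \<B>\<^sub>0(3)[OF A(2)] A(1) unfolding \<B>_def by fast
      then obtain B where B: "\<And>j. j \<in> {1..m} \<Longrightarrow> B j \<in> \<B> \<and> B j \<subseteq> A j" by metis
      \<comment> \<open>Restricting \<open>B\<close> puts it in the extensional product that indexes
        the visiting conditions; it is this finite product of countable sets that keeps
        \<open>\<G>\<close> countable.\<close>
      have "vis (restrict B {1..m}) \<in> \<G>" unfolding \<G>_def using B by auto
      then obtain l where "\<forall>j\<in>{1..m}. u (l * m + j) \<in> B j" using u(1) unfolding vis_def by auto
      then have "(\<lambda>j\<in>{1..m}. u (l * m + j)) \<in> S" using A(3) B by force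
      then show "range (\<lambda>l. \<lambda>j\<in>{1..m}. u (l * m + j)) \<inter> S \<noteq> {}" by blast
    qed
  qed
qed

section \<open>Linear combinations of blocks\<close>

lemma vectorspace_power_space:
  assumes "vectorspace scalar_field V"
  shows "vectorspace scalar_field (power_space m V)"
proof -
  interpret V: vectorspace scalar_field V by (fact assms)
  have "module scalar_field (power_space m V)"
  proof (rule moduleI)
    show "abelian_group (power_space m V)"
    proof (rule abelian_groupI)
      fix x assume "x \<in> carrier (power_space m V)"
      then show "\<exists>y\<in>carrier (power_space m V). y \<oplus>\<^bsub>power_space m V\<^esub> x = \<zero>\<^bsub>power_space m V\<^esub>"
        by (intro bexI[of _ "\<lambda>j\<in>{1..m}. \<ominus>\<^bsub>V\<^esub> x j"])
          (auto simp: power_space_def PiE_iff V.l_neg fun_eq_iff)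
    qed (auto simp: power_space_def PiE_iff fun_eq_iff extensional_def V.a_ac)
  qed (auto simp: power_space_def PiE_iff fun_eq_iff V.is_cring V.smult_l_distr V.smult_r_distr
        V.smult_assoc1 extensional_def)
  then show ?thesis by (intro vectorspace.intro V.field_axioms)
qed

lemma (in mod_hom) hom_finsum:
  assumes "finite A" and "g \<in> A \<rightarrow> carrier M"
  shows "f (\<Oplus>\<^bsub>M\<^esub>a\<in>A. g a) = (\<Oplus>\<^bsub>N\<^esub>a\<in>A. f (g a))"
  using assms
proof (induction A rule: finite_induct)
  case (insert a A)
  then show ?case by (simp add: Pi_def)
qed simp

text \<open>Transports the defining property from index sets \<open>{1..k}\<close> to any finite
  non-empty set along an enumeration. The application is to the set of indices with nonzero
  coefficient, which need not be an interval.\<close>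

lemma D_phenomenon_finite_sum:
  fixes \<alpha> :: "'s \<Rightarrow> 'k::real_normed_field"
  assumes D: "D_phenomenon X Y \<tau>Y \<Psi>"
    and X: "vectorspace scalar_field X" and Y: "vectorspace scalar_field Y"
    and \<tau>Y: "topspace \<tau>Y \<subseteq> carrier Y"
    and S: "finite S" "S \<noteq> {}"
    and x: "\<And>s. s \<in> S \<Longrightarrow> \<alpha> s \<noteq> 0 \<and> x s \<in> carrier X"
    and V: "V \<in> \<Psi> (\<Oplus>\<^bsub>X\<^esub>s\<in>S. \<alpha> s \<odot>\<^bsub>X\<^esub> x s)"
  obtains W where "\<And>s. s \<in> S \<Longrightarrow> W s \<in> \<Psi> (x s)"
    and "\<And>w. (\<And>s. s \<in> S \<Longrightarrow> w s \<in> W s) \<Longrightarrow> (\<Oplus>\<^bsub>Y\<^esub>s\<in>S. \<alpha> s \<odot>\<^bsub>Y\<^esub> w s) \<in> V"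
proof -
  interpret X: vectorspace scalar_field X by (fact X)
  interpret Y: vectorspace scalar_field Y by (fact Y)
  have UNIV: "carrier scalar_field = (UNIV :: 'k set)" by (simp add: scalar_field_def)
  define k where "k = card S"
  obtain h where h: "bij_betw h {1..k} S"
    using ex_bij_betw_nat_finite_1[OF S(1)] unfolding k_def by blast
  then have inj: "inj_on h {1..k}" and im: "S = h ` {1..k}" by (auto simp: bij_betw_def)
  have "1 \<le> k" using S unfolding k_def by (simp add: Suc_le_eq card_gt_0_iff)
  have "(\<Oplus>\<^bsub>X\<^esub>s\<in>S. \<alpha> s \<odot>\<^bsub>X\<^esub> x s) = (\<Oplus>\<^bsub>X\<^esub>j\<in>{1..k}. \<alpha> (h j) \<odot>\<^bsub>X\<^esub> x (h j))"
    unfolding im using x by (intro X.finsum_reindex inj) (auto simp: im UNIV)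
  moreover have "\<forall>j\<in>{1..k}. \<alpha> (h j) \<noteq> 0 \<and> x (h j) \<in> carrier X" using x im by auto
  ultimately obtain W where
      W: "\<forall>j\<in>{1..k}. W j \<in> \<Psi> (x (h j)) \<and> W j \<noteq> {} \<and> openin \<tau>Y (W j)"
      "{(\<Oplus>\<^bsub>Y\<^esub>j\<in>{1..k}. \<alpha> (h j) \<odot>\<^bsub>Y\<^esub> w j) |w. \<forall>j\<in>{1..k}. w j \<in> W j} \<subseteq> V"
    using D[unfolded D_phenomenon_def, THEN conjunct2, rule_format,
        of k "\<lambda>j. \<alpha> (h j)" "\<lambda>j. x (h j)" V] V \<open>1 \<le> k\<close> by auto
  define g where "g = inv_into {1..k} h"
  have g: "g s \<in> {1..k}" "h (g s) = s" if "s \<in> S" for s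
    using that unfolding g_def im
    by (auto intro: inv_into_into f_inv_into_f simp del: atLeastAtMost_iff)
  have gh: "g (h j) = j" if "j \<in> {1..k}" for j
    using that inj by (simp add: g_def)
  show ?thesis
  proof
    show "W (g s) \<in> \<Psi> (x s)" if "s \<in> S" for s using W(1) g[OF that] by metis
    show "(\<Oplus>\<^bsub>Y\<^esub>s\<in>S. \<alpha> s \<odot>\<^bsub>Y\<^esub> w s) \<in> V" if w: "\<And>s. s \<in> S \<Longrightarrow> w s \<in> W (g s)" for w
    proof -
      \<comment> \<open>The sets \<open>W j\<close> are open, hence inside
        \<open>topspace \<tau>Y\<close>; this membership is what permits reindexing the sum in
        \<open>Y\<close>.\<close>
      have "w s \<in> carrier Y" if "s \<in> S" for s
        using w[OF that] W(1) g(1)[OF that] \<tau>Y openin_subset by blast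
      then have "(\<Oplus>\<^bsub>Y\<^esub>s\<in>S. \<alpha> s \<odot>\<^bsub>Y\<^esub> w s) = (\<Oplus>\<^bsub>Y\<^esub>j\<in>{1..k}. \<alpha> (h j) \<odot>\<^bsub>Y\<^esub> w (h j))"
        unfolding im by (intro Y.finsum_reindex inj) (auto simp: im UNIV)
      moreover have "\<forall>j\<in>{1..k}. w (h j) \<in> W j" using w gh im by (metis imageI)
      ultimately show ?thesis by (intro subsetD[OF W(2)] CollectI exI[of _ "\<lambda>j. w (h j)"]) simp
    qed
  qed
qed

text \<open>A general element of the span of the blocks. Blocks are numbered from 0 while places
  within a block run from 1, so block \<open>l\<close> occupies the positions
  \<open>l * m + 1\<close> to \<open>l * m + m\<close>.\<close>

definition block_sum ::
    "('k, 'a) module \<Rightarrow> nat \<Rightarrow> (nat \<Rightarrow> 'a) \<Rightarrow> nat \<Rightarrow> (nat \<Rightarrow> 'k) \<Rightarrow> nat \<Rightarrow> 'a" where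
  "block_sum X m u L c = (\<lambda>j\<in>{1..m}. \<Oplus>\<^bsub>X\<^esub>l\<in>{..<L}. c l \<odot>\<^bsub>X\<^esub> u (l * m + j))"

text \<open>Decodes a position of \<open>u\<close> into block number and place. Positions and places
  count from 1, hence the shift by one before division and back after the remainder.\<close>

lemma block_index:
  assumes "j \<in> {1..m}"
  shows "(l * m + j - 1) div m = l" and "(l * m + j - 1) mod m + 1 = (j::nat)"
proof -
  obtain i where "j = Suc i" "i < m" using assms by (cases j) auto
  then show "(l * m + j - 1) div m = l" "(l * m + j - 1) mod m + 1 = j" by auto
qed

lemma block_index_inverse:
  assumes "k \<in> {1..L * m}"
  shows "(k - 1) div m < L" and "(k - 1) mod m + 1 \<in> {1..m}"
    and "(k - 1) div m * m + ((k - 1) mod m + 1) = (k::nat)"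
proof -
  have "m > 0" and "k - 1 < L * m" using assms by (auto intro: gr0I)
  then show "(k - 1) div m < L" "(k - 1) mod m + 1 \<in> {1..m}"
    by (auto simp: less_mult_imp_div_less Suc_le_eq)
  show "(k - 1) div m * m + ((k - 1) mod m + 1) = k"
    using assms by (simp flip: add.assoc)
qed

text \<open>Each coordinate \<open>j\<close> of the combination is a sum of terms
  \<open>u (l * m + j)\<close>, and different \<open>j\<close> use disjoint positions of
  \<open>u\<close>. The neighbourhoods obtained separately for each coordinate therefore fit
  together into one product over all \<open>L * m\<close> positions, and upward heredity of
  \<open>\<F>\<close> transfers its return times to \<open>V\<close>.\<close>

lemma block_sum_in_F_Psi:
  fixes X :: "('k::real_normed_field, 'a) module" and Y :: "('k, 'b) module"
  assumes lin: "\<And>n. 1 \<le> n \<Longrightarrow> linear_map scalar_field X Y (T n)"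
    and X: "vectorspace scalar_field X"
    and Y: "topological_vector_space Y \<tau>Y"
    and D: "D_phenomenon X Y \<tau>Y \<Psi>"
    and \<F>: "Furstenberg_family \<F>"
    and u: "\<And>k. u k \<in> carrier X"
    and uF: "restrict u {1..L * m} \<in> F_Psi X \<F> \<Psi> T (L * m)"
    and c: "\<exists>l<L. c l \<noteq> 0"
  shows "block_sum X m u L c \<in> F_Psi X \<F> \<Psi> T m"
proof -
  interpret X: vectorspace scalar_field X by (fact X)
  have Yv: "vectorspace scalar_field Y" and \<tau>Y: "topspace \<tau>Y \<subseteq> carrier Y"
    using Y unfolding topological_vector_space_def by auto
  have UNIV: "carrier scalar_field = (UNIV :: 'k set)" by (simp add: scalar_field_def)
  have scalar_zero: "\<zero>\<^bsub>scalar_field\<^esub> = (0::'k)" by (simp add: scalar_field_def)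
  have smult0: "(0::'k) \<odot>\<^bsub>X\<^esub> v = \<zero>\<^bsub>X\<^esub>" if "v \<in> carrier X" for v
    using X.smult_l_null[OF that] by (simp add: scalar_zero)
  \<comment> \<open>A \<open>D\<close>-phenomenon only speaks of combinations with nonzero scalars,
    so zero coefficients are dropped first.\<close>
  define S where "S = {l. l < L \<and> c l \<noteq> 0}"
  have S: "finite S" "S \<noteq> {}" "S \<subseteq> {..<L}" using c unfolding S_def by auto
  define p where "p j = (\<Oplus>\<^bsub>X\<^esub>l\<in>S. c l \<odot>\<^bsub>X\<^esub> u (l * m + j))" for j
  have p_closed: "p j \<in> carrier X" for j
    unfolding p_def using u by (intro X.finsum_closed) (auto simp: UNIV)
  have "(\<Oplus>\<^bsub>X\<^esub>l\<in>{..<L}. c l \<odot>\<^bsub>X\<^esub> u (l * m + j)) = p j" for j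
    unfolding p_def using S u
    by (intro X.add.finprod_mono_neutral_cong_right) (auto simp: UNIV S_def smult0)
  then have q: "block_sum X m u L c = (\<lambda>j\<in>{1..m}. p j)"
    unfolding block_sum_def by simp
  have "{n. 1 \<le> n \<and> (\<lambda>j\<in>{1..m}. T n ((\<lambda>j\<in>{1..m}. p j) j)) \<in> V} \<in> \<F>"
    if tuple: "V \<in> tuple_phenomenon m \<Psi> (\<lambda>j\<in>{1..m}. p j)" for V
  proof -
    obtain A where V: "V = Pi\<^sub>E {1..m} A" and A: "\<And>j. j \<in> {1..m} \<Longrightarrow> A j \<in> \<Psi> (p j)"
      using tuple unfolding tuple_phenomenon_def by auto
    have "\<exists>W. (\<forall>l\<in>S. W l \<in> \<Psi> (u (l * m + j))) \<and>
            (\<forall>w. (\<forall>l\<in>S. w l \<in> W l) \<longrightarrow> (\<Oplus>\<^bsub>Y\<^esub>l\<in>S. c l \<odot>\<^bsub>Y\<^esub> w l) \<in> A j)"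
      if "j \<in> {1..m}" for j
    proof -
      have "\<And>l. l \<in> S \<Longrightarrow> c l \<noteq> 0 \<and> u (l * m + j) \<in> carrier X" using u by (auto simp: S_def)
      from D_phenomenon_finite_sum[OF D X Yv \<tau>Y S(1,2) this A[OF that, unfolded p_def]]
      show ?thesis by metis
    qed
    then obtain W where
        W: "\<And>j l. j \<in> {1..m} \<Longrightarrow> l \<in> S \<Longrightarrow> W j l \<in> \<Psi> (u (l * m + j))"
          "\<And>j w. j \<in> {1..m} \<Longrightarrow> (\<forall>l\<in>S. w l \<in> W j l) \<Longrightarrow> (\<Oplus>\<^bsub>Y\<^esub>l\<in>S. c l \<odot>\<^bsub>Y\<^esub> w l) \<in> A j"
      by metis
    \<comment> \<open>Positions in blocks with coefficient zero do not affect \<open>p\<close>; any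
      member of the non-empty \<open>\<Psi> (u k)\<close> serves there.\<close>
    define Z where "Z k = (if (k - 1) div m \<in> S then W ((k - 1) mod m + 1) ((k - 1) div m)
                           else SOME Q. Q \<in> \<Psi> (u k))" for k
    have Z: "Z k \<in> \<Psi> (u k)" if "k \<in> {1..L * m}" for k
    proof (cases "(k - 1) div m \<in> S")
      case True
      then show ?thesis
        using W(1)[OF block_index_inverse(2)[OF that] True] block_index_inverse(3)[OF that]
        by (simp add: Z_def)
    next
      case False
      have "\<Psi> (u k) \<noteq> {}" using D u unfolding D_phenomenon_def by blast
      with False show ?thesis by (simp add: Z_def some_in_eq)
    qed
    have "Pi\<^sub>E {1..L * m} Z \<in> tuple_phenomenon (L * m) \<Psi> (restrict u {1..L * m})"
      unfolding tuple_phenomenon_def using Z by auto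
    then have "{n. 1 \<le> n \<and> (\<lambda>k\<in>{1..L * m}. T n (restrict u {1..L * m} k)) \<in> Pi\<^sub>E {1..L * m} Z} \<in> \<F>"
      using uF unfolding F_Psi_def by blast
    moreover have "{n. 1 \<le> n \<and> (\<lambda>k\<in>{1..L * m}. T n (restrict u {1..L * m} k)) \<in> Pi\<^sub>E {1..L * m} Z}
      \<subseteq> {n. 1 \<le> n \<and> (\<lambda>j\<in>{1..m}. T n ((\<lambda>j\<in>{1..m}. p j) j)) \<in> V}"
    proof (intro subsetI CollectI, elim CollectE conjE, intro conjI)
      fix n assume n: "1 \<le> n"
        and mem: "(\<lambda>k\<in>{1..L * m}. T n (restrict u {1..L * m} k)) \<in> Pi\<^sub>E {1..L * m} Z"
      then have TZ: "T n (u k) \<in> Z k" if "k \<in> {1..L * m}" for k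
        using that by (auto simp: PiE_iff)
      interpret T: linear_map scalar_field X Y "T n" by (rule lin[OF n])
      have "T n (p j) \<in> A j" if j: "j \<in> {1..m}" for j
      proof -
        have "T n (p j) = (\<Oplus>\<^bsub>Y\<^esub>l\<in>S. T n (c l \<odot>\<^bsub>X\<^esub> u (l * m + j)))"
          unfolding p_def using u S by (intro T.hom_finsum) (auto simp: UNIV)
        also have "\<dots> = (\<Oplus>\<^bsub>Y\<^esub>l\<in>S. c l \<odot>\<^bsub>Y\<^esub> T n (u (l * m + j)))"
          using u by (simp add: UNIV)
        also have "\<dots> \<in> A j"
        proof (rule W(2)[OF j], rule ballI)
          fix l assume l: "l \<in> S"
          \<comment> \<open>The position lies in the initial segment because
            \<open>(l + 1) * m\<close> is at most \<open>L * m\<close>.\<close>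
          have "l * m + j \<le> l * m + m" using j by simp
          also have "\<dots> \<le> L * m"
            using l S(3) mult_le_mono1[of "Suc l" L m] by (auto simp: Suc_le_eq add.commute)
          finally have "l * m + j \<in> {1..L * m}" using j by simp
          from TZ[OF this] show "T n (u (l * m + j)) \<in> W j l"
            unfolding Z_def block_index[OF j] using l by simp
        qed
        finally show ?thesis .
      qed
      then show "(\<lambda>j\<in>{1..m}. T n ((\<lambda>j\<in>{1..m}. p j) j)) \<in> V" unfolding V by auto
    qed simp
    ultimately show ?thesis using \<F> unfolding Furstenberg_family_def by blast
  qed
  then show ?thesis
    unfolding q F_Psi_def using p_closed by (auto simp: power_space_def)
qed

text \<open>Two combinations of different lengths are added after padding both with zero
  coefficients to a common length.\<close>

lemma subspace_block_sums:
  fixes X :: "('k::field, 'a) module"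
  assumes X: "vectorspace scalar_field X" and u: "\<And>k. u k \<in> carrier X"
  shows "VectorSpace.subspace scalar_field {block_sum X m u L c |L c. True} (power_space m X)"
proof -
  interpret X: vectorspace scalar_field X by (fact X)
  have UNIV: "carrier scalar_field = (UNIV :: 'k set)" by (simp add: scalar_field_def)
  have scalar_ops: "\<zero>\<^bsub>scalar_field\<^esub> = (0::'k)" "a \<oplus>\<^bsub>scalar_field\<^esub> b = a + b"
    "a \<otimes>\<^bsub>scalar_field\<^esub> b = a * b" for a b :: 'k by (simp_all add: scalar_field_def)
  have smult0: "(0::'k) \<odot>\<^bsub>X\<^esub> v = \<zero>\<^bsub>X\<^esub>" if "v \<in> carrier X" for v
    using X.smult_l_null[OF that] by (simp add: scalar_ops)
  have closed: "(\<lambda>l. c l \<odot>\<^bsub>X\<^esub> u (l * m + j)) \<in> A \<rightarrow> carrier X" for c :: "nat \<Rightarrow> 'k" and A j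
    using u by (auto simp: UNIV)
  have extend: "\<exists>c'. block_sum X m u L c = block_sum X m u L' c'" if "L \<le> L'" for L L' c
  proof (rule exI)
    show "block_sum X m u L c = block_sum X m u L' (\<lambda>l. if l < L then c l else 0)"
      unfolding block_sum_def using that closed u
      by (intro restrict_ext X.add.finprod_mono_neutral_cong_left) (auto simp: smult0 UNIV)
  qed
  have add: "block_sum X m u L c \<oplus>\<^bsub>power_space m X\<^esub> block_sum X m u L c'
      = block_sum X m u L (\<lambda>l. c l + c' l)" for L c c'
  proof -
    have "(\<Oplus>\<^bsub>X\<^esub>l\<in>{..<L}. (c l + c' l) \<odot>\<^bsub>X\<^esub> u (l * m + j))
      = (\<Oplus>\<^bsub>X\<^esub>l\<in>{..<L}. c l \<odot>\<^bsub>X\<^esub> u (l * m + j) \<oplus>\<^bsub>X\<^esub> c' l \<odot>\<^bsub>X\<^esub> u (l * m + j))" for j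
      using X.smult_l_distr[of _ _ "u _"] u by (intro X.finsum_cong') (auto simp: UNIV scalar_ops)
    then show ?thesis
      by (auto simp: block_sum_def power_space_def X.finsum_addf[OF closed closed] fun_eq_iff)
  qed
  have smult: "a \<odot>\<^bsub>power_space m X\<^esub> block_sum X m u L c = block_sum X m u L (\<lambda>l. a * c l)"
    for a L c
  proof -
    have "a \<odot>\<^bsub>X\<^esub> (\<Oplus>\<^bsub>X\<^esub>l\<in>{..<L}. c l \<odot>\<^bsub>X\<^esub> u (l * m + j))
        = (\<Oplus>\<^bsub>X\<^esub>l\<in>{..<L}. a \<odot>\<^bsub>X\<^esub> (c l \<odot>\<^bsub>X\<^esub> u (l * m + j)))" for j
      by (intro X.finsum_smult_ldistr closed) (auto simp: UNIV)
    also have "\<dots> j = (\<Oplus>\<^bsub>X\<^esub>l\<in>{..<L}. (a * c l) \<odot>\<^bsub>X\<^esub> u (l * m + j))" for j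
      using X.smult_assoc1[of _ _ "u _"] u by (intro X.finsum_cong') (auto simp: UNIV scalar_ops)
    finally show ?thesis
      by (auto simp: block_sum_def power_space_def fun_eq_iff)
  qed
  interpret P: vectorspace scalar_field "power_space m X" by (rule vectorspace_power_space[OF X])
  show ?thesis
  proof (intro subspace.intro submodule.intro P.vectorspace_axioms P.module_axioms)
    show "{block_sum X m u L c |L c. True} \<subseteq> carrier (power_space m X)"
      using closed by (auto simp: block_sum_def power_space_def)
    have "\<zero>\<^bsub>power_space m X\<^esub> = block_sum X m u 0 (\<lambda>_. 0)"
      by (simp add: block_sum_def power_space_def)
    then show "\<zero>\<^bsub>power_space m X\<^esub> \<in> {block_sum X m u L c |L c. True}" by blast
    show "v \<oplus>\<^bsub>power_space m X\<^esub> w \<in> {block_sum X m u L c |L c. True}"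
      if vw: "v \<in> {block_sum X m u L c |L c. True}" "w \<in> {block_sum X m u L c |L c. True}" for v w
    proof -
      obtain L c L' c' where "v = block_sum X m u L c" "w = block_sum X m u L' c'" using vw by blast
      moreover obtain d d' where "block_sum X m u L c = block_sum X m u (max L L') d"
          "block_sum X m u L' c' = block_sum X m u (max L L') d'"
        using extend[of L "max L L'" c] extend[of L' "max L L'" c'] by auto
      ultimately show ?thesis using add by auto
    qed
    show "a \<odot>\<^bsub>power_space m X\<^esub> v \<in> {block_sum X m u L c |L c. True}"
      if "v \<in> {block_sum X m u L c |L c. True}" for a v
      using that smult by blast
  qed
qed

text \<open>Unit coefficient vectors recover the blocks themselves, so the span inherits their
  density.\<close>

lemma block_in_block_sums:
  fixes X :: "('k::field, 'a) module"
  assumes X: "vectorspace scalar_field X" and u: "\<And>k. u k \<in> carrier X"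
  shows "(\<lambda>j\<in>{1..m}. u (l * m + j)) = block_sum X m u (Suc l) (\<lambda>i. if i = l then 1 else 0)"
proof -
  interpret X: vectorspace scalar_field X by (fact X)
  have UNIV: "carrier scalar_field = (UNIV :: 'k set)" by (simp add: scalar_field_def)
  have smult: "(0::'k) \<odot>\<^bsub>X\<^esub> v = \<zero>\<^bsub>X\<^esub>" "(1::'k) \<odot>\<^bsub>X\<^esub> v = v" if "v \<in> carrier X" for v
    using X.smult_l_null[OF that] X.smult_one[OF that] by (simp_all add: scalar_field_def)
  have "(\<Oplus>\<^bsub>X\<^esub>i\<in>{..<Suc l}. (if i = l then 1 else 0 :: 'k) \<odot>\<^bsub>X\<^esub> u (i * m + j))
      = (\<Oplus>\<^bsub>X\<^esub>i\<in>{l}. u (i * m + j))" for j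
    using u by (intro X.add.finprod_mono_neutral_cong_right) (auto simp: smult UNIV)
  then show ?thesis using u by (auto simp: block_sum_def fun_eq_iff)
qed

section \<open>Assembly of the dense subspace from a generic sequence\<close>

theorem theorem4p3:
  fixes X :: "('k::real_normed_field, 'a) module" and \<tau>X :: "'a topology"
    and Y :: "nat \<Rightarrow> ('k, 'b) module" and \<tau>Y :: "nat \<Rightarrow> 'b topology"
    and T :: "nat \<Rightarrow> nat \<Rightarrow> 'a \<Rightarrow> 'b"
    and \<Psi> :: "nat \<Rightarrow> 'a \<Rightarrow> 'b set set"
    and \<F> :: "nat \<Rightarrow> nat set set"
  assumes "F_space X \<tau>X" and "separable_space \<tau>X" and "infinite_dimensional X"
    and "\<And>i. 1 \<le> i \<Longrightarrow> topological_vector_space (Y i) (\<tau>Y i)"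
    and "\<And>i n. 1 \<le> i \<Longrightarrow> 1 \<le> n \<Longrightarrow> linear_map scalar_field X (Y i) (T i n)"
    and "\<And>i. 1 \<le> i \<Longrightarrow> D_phenomenon X (Y i) (\<tau>Y i) (\<Psi> i)"
    and "\<And>i. 1 \<le> i \<Longrightarrow> proper_Furstenberg_family (\<F> i)"
    and "\<And>m i. 1 \<le> m \<Longrightarrow> 1 \<le> i \<Longrightarrow>
           \<exists>R. residual_in (power_topology m \<tau>X) R \<and> R \<subseteq> F_Psi X (\<F> i) (\<Psi> i) (T i) m"
  shows "\<forall>m\<ge>1. dense_lineable (power_space m X) (power_topology m \<tau>X)
           (\<Inter>i\<in>{1..}. F_Psi X (\<F> i) (\<Psi> i) (T i) m)"
proof (intro allI impI)
  fix m :: nat assume m: "1 \<le> m"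
  have X: "vectorspace scalar_field X" and top: "topspace \<tau>X = carrier X"
    and compl: "completely_metrizable_space \<tau>X"
    using assms(1) unfolding F_space_def topological_vector_space_def by auto
  interpret X: vectorspace scalar_field X by (fact X)
  have "topspace \<tau>X \<noteq> {}" using X.zero_closed top by auto
  obtain R where R: "\<And>N i. 1 \<le> N \<Longrightarrow> 1 \<le> i \<Longrightarrow> residual_in (power_topology N \<tau>X) (R N i)"
      "\<And>N i. 1 \<le> N \<Longrightarrow> 1 \<le> i \<Longrightarrow> R N i \<subseteq> F_Psi X (\<F> i) (\<Psi> i) (T i) N"
    using assms(8) by metis
  obtain u where "range u \<subseteq> topspace \<tau>X"
    and uR: "\<And>N i. 1 \<le> N \<Longrightarrow> 1 \<le> i \<Longrightarrow> restrict u {1..N} \<in> R N i"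
    and dense: "power_topology m \<tau>X closure_of range (\<lambda>l. \<lambda>j\<in>{1..m}. u (l * m + j))
                  = topspace (power_topology m \<tau>X)"
    using generic_sequence[where R = R, OF compl assms(2) \<open>topspace \<tau>X \<noteq> {}\<close> m R(1)]
    by blast
  then have u: "u k \<in> carrier X" for k using top by auto
  define W where "W = {block_sum X m u L c |L c. True}"
  have "W \<subseteq> (\<Inter>i\<in>{1..}. F_Psi X (\<F> i) (\<Psi> i) (T i) m) \<union> {\<zero>\<^bsub>power_space m X\<^esub>}"
  proof
    fix v assume "v \<in> W"
    then obtain L c where v: "v = block_sum X m u L c" unfolding W_def by blast
    show "v \<in> (\<Inter>i\<in>{1..}. F_Psi X (\<F> i) (\<Psi> i) (T i) m) \<union> {\<zero>\<^bsub>power_space m X\<^esub>}"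
    \<comment> \<open>The split is on the coefficients, not on \<open>v\<close>: a combination with
      some nonzero coefficient lies in the intersection whatever its value, and one with none is the
      zero tuple.\<close>
    proof (cases "\<exists>l<L. c l \<noteq> 0")
      case True
      \<comment> \<open>A nonzero coefficient forces \<open>L\<close> to be positive, so the
        residual set for length \<open>L * m\<close> is available.\<close>
      then have L: "1 \<le> L * m" using m by auto
      have "v \<in> F_Psi X (\<F> i) (\<Psi> i) (T i) m" if i: "1 \<le> i" for i
        unfolding v
      proof (rule block_sum_in_F_Psi[OF assms(5)[OF i] X assms(4)[OF i] assms(6)[OF i] _ u _ True])
        show "Furstenberg_family (\<F> i)"
          using assms(7)[OF i] unfolding proper_Furstenberg_family_def by simp
        show "restrict u {1..L * m} \<in> F_Psi X (\<F> i) (\<Psi> i) (T i) (L * m)"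
          using uR[OF L i] R(2)[OF L i] by blast
      qed
      then show ?thesis by auto
    next
      case False
      have "0 \<odot>\<^bsub>X\<^esub> u k = \<zero>\<^bsub>X\<^esub>" for k
        using X.smult_l_null[OF u] by (simp add: scalar_field_def)
      with False have "c l \<odot>\<^bsub>X\<^esub> u k = \<zero>\<^bsub>X\<^esub>" if "l < L" for l k
        using that by auto
      then have "(\<Oplus>\<^bsub>X\<^esub>l\<in>{..<L}. c l \<odot>\<^bsub>X\<^esub> u (l * m + j)) = (\<Oplus>\<^bsub>X\<^esub>l\<in>{..<L}. \<zero>\<^bsub>X\<^esub>)" for j
        by (intro X.finsum_cong') auto
      then have "v = \<zero>\<^bsub>power_space m X\<^esub>"
        unfolding v by (simp add: block_sum_def power_space_def)
      then show ?thesis by simp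
    qed
  qed
  moreover have "power_topology m \<tau>X closure_of W = topspace (power_topology m \<tau>X)"
  proof -
    have "range (\<lambda>l. \<lambda>j\<in>{1..m}. u (l * m + j)) \<subseteq> W"
      unfolding W_def using block_in_block_sums[where u = u, OF X u] by blast
    from closure_of_mono[OF this] dense show ?thesis
      using closure_of_subset_topspace by (metis subset_antisym)
  qed
  ultimately show "dense_lineable (power_space m X) (power_topology m \<tau>X)
      (\<Inter>i\<in>{1..}. F_Psi X (\<F> i) (\<Psi> i) (T i) m)"
    using subspace_block_sums[where u = u and m = m, OF X u] unfolding dense_lineable_def W_def by blast
qed

end
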